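(* Let $V$ be a nonsingular $m\times m$ matrix over $\mathbb{F}_p$ and let $\Phi:\mathcal{R}^n\to\mathbb{F}_p^{mn}$ be the associated Gray map. Then $\Phi$ is $\mathbb{F}_p$-linear, one-to-one and onto, and it is a distance preserving map from ($\mathcal{R}^n$, Gray distance $d_G$) to ($\mathbb{F}_p^{mn}$, Hamming distance). Further, if $V$ satisfies $VV^T=\lambda I_m$ for some $\lambda\in\mathbb{F}_p^*$ (where $V^T$ is the transpose of $V$ and $I_m$ the identity matrix of order $m$), then for every self-dual code $\mathcal{C}$ of length $n$ over $\mathcal{R}$ the Gray image $\Phi(\mathcal{C})$ is a self-dual code in $\mathbb{F}_p^{mn}$.
   Context: Let $m\ge 2$ be a natural number, $p$ a prime with $p\equiv 1 \pmod{m-1}$, and $\mathcal{R}=\mathbb{F}_p[u]/\langle u^m-u\rangle=\mathbb{F}_p+u\mathbb{F}_p+\cdots+u^{m-1}\mathbb{F}_p$ with $u^m=u$. Let $\alpha$ be a primitive element of $\mathbb{F}_p$ and $\xi=\alpha^{(p-1)/(m-1)}$, an element of multiplicative order $m-1$ in $\mathbb{F}_p$. Gray map: for $r=r(u)=a_0+a_1u+\cdots+a_{m-1}u^{m-1}\in\mathcal{R}$ with $a_i\in\mathbb{F}_p$, put $\Phi(r)=(r(0),r(1),r(\xi),\dots,r(\xi^{m-2}))\,V\in\mathbb{F}_p^m$ (row vector times matrix). It is extended componentwise to $\Phi:\mathcal{R}^n\to\mathbb{F}_p^{mn}$. The Gray weight of $r\in\mathcal{R}$ is $w_G(r)=w_H(\Phi(r))$,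 where $w_H$ is Hamming weight; for $c=(c_0,\dots,c_{n-1})\in\mathcal{R}^n$, $w_G(c)=\sum_{i}w_G(c_i)=w_H(\Phi(c))$; the Gray distance is $d_G(c_1,c_2)=w_G(c_1-c_2)=w_H(\Phi(c_1)-\Phi(c_2))$. A linear code of length $n$ over $\mathcal{R}$ is an $\mathcal{R}$-submodule $\mathcal{C}$ of $\mathcal{R}^n$; $\mathcal{C}^\perp=\{x\in\mathcal{R}^n: x\cdot y=0\ \forall y\in\mathcal{C}\}$ for the Euclidean inner product, and $\mathcal{C}$ is self-dual if $\mathcal{C}=\mathcal{C}^\perp$. Same definitions over $\mathbb{F}_p$. *)

theory Defs
  imports
    "HOL-Algebra.QuotRing"
    "HOL-Number_Theory.Cong"
    "Jordan_Normal_Form.VS_Connect"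
    "Berlekamp_Zassenhaus.Finite_Field"
begin

hide_const (open) Multiset.mult Polynomial.smult Modules.module up_ring.monom

section \<open>Codes over a commutative ring\<close>

text \<open>
  \<open>free_module R n\<close> is $R^n$. The fields \<open>mult\<close> and \<open>one\<close> of the record are not part of
  the module structure.
\<close>

definition free_module :: "('a, 'b) ring_scheme \<Rightarrow> nat \<Rightarrow> ('a, 'a vec) module" where
  "free_module R n = \<lparr>
     carrier = {x \<in> carrier_vec n. \<forall>i<n. x $ i \<in> carrier R},
     mult = undefined,
     one = undefined,
     zero = vec n (\<lambda>_. \<zero>\<^bsub>R\<^esub>),
     add = (\<lambda>x y. vec n (\<lambda>i. x $ i \<oplus>\<^bsub>R\<^esub> y $ i)),
     smult = (\<lambda>a x. vec n (\<lambda>i. a \<otimes>\<^bsub>R\<^esub> x $ i))\<rparr>"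

definition linear_code :: "('a, 'b) ring_scheme \<Rightarrow> nat \<Rightarrow> 'a vec set \<Rightarrow> bool" where
  "linear_code R n C \<longleftrightarrow> LinearCombinations.submodule R C (free_module R n)"

definition euclidean_inner :: "('a, 'b) ring_scheme \<Rightarrow> nat \<Rightarrow> 'a vec \<Rightarrow> 'a vec \<Rightarrow> 'a" where
  "euclidean_inner R n x y = (\<Oplus>\<^bsub>R\<^esub>i\<in>{..<n}. x $ i \<otimes>\<^bsub>R\<^esub> y $ i)"

definition dual_code :: "('a, 'b) ring_scheme \<Rightarrow> nat \<Rightarrow> 'a vec set \<Rightarrow> 'a vec set" where
  "dual_code R n C =
     {x \<in> carrier (free_module R n). \<forall>y\<in>C. euclidean_inner R n x y = \<zero>\<^bsub>R\<^esub>}"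

definition self_dual_code :: "('a, 'b) ring_scheme \<Rightarrow> nat \<Rightarrow> 'a vec set \<Rightarrow> bool" where
  "self_dual_code R n C \<longleftrightarrow> linear_code R n C \<and> C = dual_code R n C"

lemma module_free_module:
  assumes "cring R"
  shows "module R (free_module R n)"
proof -
  interpret R: cring R by fact
  have closed: "x $ i \<in> carrier R" "dim_vec x = n"
    if "x \<in> carrier (free_module R n)" "i < n" for x i
    using that by (auto simp: free_module_def)
  have dim: "dim_vec x = n" if "x \<in> carrier (free_module R n)" for x
    using that by (auto simp: free_module_def)
  have add: "x \<oplus>\<^bsub>free_module R n\<^esub> y = vec n (\<lambda>i. x $ i \<oplus>\<^bsub>R\<^esub> y $ i)" for x y
    by (simp add: free_module_def)
  have smult: "a \<odot>\<^bsub>free_module R n\<^esub> x = vec n (\<lambda>i. a \<otimes>\<^bsub>R\<^esub> x $ i)" for a x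
    by (simp add: free_module_def)
  have zero: "\<zero>\<^bsub>free_module R n\<^esub> = vec n (\<lambda>_. \<zero>\<^bsub>R\<^esub>)"
    by (simp add: free_module_def)
  have vec: "vec n f \<in> carrier (free_module R n)" if "\<And>i. i < n \<Longrightarrow> f i \<in> carrier R" for f
    using that by (simp add: free_module_def)
  have "abelian_group (free_module R n)"
  proof (rule abelian_groupI, goal_cases)
    case (6 x)
    show ?case
      by (rule bexI[of _ "vec n (\<lambda>i. \<ominus>\<^bsub>R\<^esub> x $ i)"])
        (use 6 in \<open>auto simp: add zero closed R.l_neg intro!: eq_vecI vec\<close>)
  qed (auto simp: add zero closed dim R.a_assoc
      intro!: eq_vecI vec intro: R.add.m_comm[OF closed(1) closed(1)])
  then show ?thesis
    by (intro moduleI assms)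
      (auto simp: add smult closed dim R.l_distr R.r_distr R.m_assoc intro!: eq_vecI vec)
qed

text \<open>Restriction of scalars along \<open>\<phi>\<close>.\<close>

definition restrict_scalars :: "('k \<Rightarrow> 'a) \<Rightarrow> ('a, 'v) module \<Rightarrow> ('k, 'v) module" where
  "restrict_scalars \<phi> M = \<lparr>
     carrier = carrier M,
     mult = mult M,
     one = one M,
     zero = zero M,
     add = add M,
     smult = (\<lambda>a x. \<phi> a \<odot>\<^bsub>M\<^esub> x)\<rparr>"


section \<open>Hamming weight and distance\<close>

definition hamming_weight :: "'a::zero vec \<Rightarrow> nat" where
  "hamming_weight x = card {i. i < dim_vec x \<and> x $ i \<noteq> 0}"

definition hamming_dist :: "'a vec \<Rightarrow> 'a vec \<Rightarrow> nat" where
  "hamming_dist x y = card {i. i < dim_vec x \<and> x $ i \<noteq> y $ i}"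


section \<open>The ring $F[u] / \langle u^m - u\rangle$\<close>

definition gray_ideal :: "nat \<Rightarrow> 'a::comm_ring_1 poly set" where
  "gray_ideal m = Idl\<^bsub>class_ring\<^esub> {monom 1 m - monom 1 1}"

definition gray_ring :: "nat \<Rightarrow> 'a::comm_ring_1 poly set ring" where
  "gray_ring m = class_ring Quot gray_ideal m"

definition const_coset :: "nat \<Rightarrow> 'a::comm_ring_1 \<Rightarrow> 'a poly set" where
  "const_coset m a = gray_ideal m +>\<^bsub>class_ring\<^esub> [:a:]"

text \<open>The representative $a_0 + a_1 u + \cdots + a_{m-1} u^{m-1}$ of a residue class.\<close>

definition coset_rep :: "nat \<Rightarrow> 'a::comm_ring_1 poly set \<Rightarrow> 'a poly" where
  "coset_rep m r = (THE f. f \<in> r \<and> degree f < m)"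

lemma cring_gray_ring: "cring (gray_ring m :: 'a::comm_ring_1 poly set ring)"
  unfolding gray_ring_def gray_ideal_def
  by (intro ideal.quotient_is_cring ring.genideal_ideal class_ring.ring_axioms
      class_cring.cring_axioms) simp

lemma gray_ideal_eq:
  "gray_ideal m = range (\<lambda>g. g * (monom 1 m - monom 1 1 :: 'a::comm_ring_1 poly))"
proof -
  have "gray_ideal m = PIdl\<^bsub>class_ring\<^esub> (monom 1 m - monom 1 1 :: 'a poly)"
    unfolding gray_ideal_def 
    by (subst cring.cgenideal_eq_genideal[OF class_cring.cring_axioms]) simp_all
  then show ?thesis by (auto simp: cgenideal_def)
qed

lemma coset_rep_unique:
  fixes r :: "'a::field poly set"
  assumes "m \<ge> 2" and "r \<in> carrier (gray_ring m)"
  shows "\<exists>!f. f \<in> r \<and> degree f < m"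
proof -
  let ?h = "monom 1 m - monom 1 1 :: 'a poly"
  have "degree (- monom 1 1 :: 'a poly) < degree (monom 1 m :: 'a poly)"
    using assms(1) by (simp only: degree_minus) (simp add: degree_monom_eq)
  then have "degree (monom 1 m + - monom 1 1 :: 'a poly) = degree (monom 1 m :: 'a poly)"
    by (rule degree_add_eq_left)
  then have "degree ?h = m"
    by (simp only: diff_conv_add_uminus) (simp add: degree_monom_eq)
  then have h: "degree ?h = m" "?h \<noteq> 0"
    using assms(1) by (auto simp only: degree_0)
  from assms(2) obtain g where r: "r = {q * ?h + g | q. True}"
    by (auto simp: gray_ring_def FactRing_def A_RCOSETS_def' a_r_coset_def' gray_ideal_eq)
  show ?thesis
  proof (rule ex1I[of _ "g mod ?h"])
    have "g mod ?h = (- (g div ?h)) * ?h + g"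
      by (simp add: minus_div_mult_eq_mod[symmetric])
    moreover have "degree (g mod ?h) < m"
      using degree_mod_less[OF h(2), of g] h(1) assms(1) by auto
    ultimately show "g mod ?h \<in> r \<and> degree (g mod ?h) < m"
      unfolding r by blast
  next
    fix f assume f: "f \<in> r \<and> degree f < m"
    then obtain q where "f = q * ?h + g" by (auto simp: r)
    then have "f mod ?h = g mod ?h" by simp
    moreover have "f mod ?h = f" using f h(1) by (intro mod_poly_less) simp
    ultimately show "f = g mod ?h" by simp
  qed
qed


section \<open>The Gray map\<close>

definition primitive_element :: "'a::field \<Rightarrow> bool" where
  "primitive_element \<alpha> \<longleftrightarrow> range (\<lambda>k::nat. \<alpha> ^ k) = UNIV - {0}"

text \<open>The row vector $(r(0), r(1), r(\xi), \ldots, r(\xi^{m-2}))$.\<close>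

definition eval_vec :: "nat \<Rightarrow> 'a::comm_ring_1 \<Rightarrow> 'a poly set \<Rightarrow> 'a vec" where
  "eval_vec m \<xi> r =
     vec m (\<lambda>k. poly (coset_rep m r) (if k = 0 then 0 else \<xi> ^ (k - 1)))"

text \<open>Row vector times matrix; \<open>(*\<^sub>v)\<close> would multiply from the other side.\<close>

definition gray_map :: "nat \<Rightarrow> 'a::comm_ring_1 \<Rightarrow> 'a mat \<Rightarrow> 'a poly set \<Rightarrow> 'a vec" where
  "gray_map m \<xi> V r = vec m (\<lambda>j. eval_vec m \<xi> r \<bullet> col V j)"

text \<open>The images of the \<open>n\<close> components are concatenated, in blocks of length \<open>m\<close>.\<close>

definition gray_map_vec ::
    "nat \<Rightarrow> 'a::comm_ring_1 \<Rightarrow> 'a mat \<Rightarrow> nat \<Rightarrow> 'a poly set vec \<Rightarrow> 'a vec" where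
  "gray_map_vec m \<xi> V n c = vec (m * n) (\<lambda>i. gray_map m \<xi> V (c $ (i div m)) $ (i mod m))"

definition gray_weight :: "nat \<Rightarrow> 'a::comm_ring_1 \<Rightarrow> 'a mat \<Rightarrow> 'a poly set \<Rightarrow> nat" where
  "gray_weight m \<xi> V r = hamming_weight (gray_map m \<xi> V r)"

definition gray_weight_vec ::
    "nat \<Rightarrow> 'a::comm_ring_1 \<Rightarrow> 'a mat \<Rightarrow> nat \<Rightarrow> 'a poly set vec \<Rightarrow> nat" where
  "gray_weight_vec m \<xi> V n c = (\<Sum>i<n. gray_weight m \<xi> V (c $ i))"

definition gray_dist ::
    "nat \<Rightarrow> 'a::comm_ring_1 \<Rightarrow> 'a mat \<Rightarrow> nat \<Rightarrow> 'a poly set vec \<Rightarrow> 'a poly set vec \<Rightarrow> nat" where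
  "gray_dist m \<xi> V n x y =
     gray_weight_vec m \<xi> V n (x \<ominus>\<^bsub>free_module (gray_ring m) n\<^esub> y)"

end

theory Submission
  imports Defs
begin

text \<open>
  Over $F = \mathbb{F}_p$ the polynomial $u^m - u$ has the $m$ pairwise different roots
  $0, 1, \xi, \ldots, \xi^{m-2}$, because the order of $\xi$ is $m - 1$. Evaluation at these
  nodes is therefore a ring isomorphism from $R = F[u]/\langle u^m - u\rangle$ to $F^m$: it is
  a homomorphism in each coordinate (\<open>node_eval_hom\<close>), injective because a reduced
  representative has degree less than $m$ (\<open>node_eval_inject\<close>), and surjective by Lagrange
  interpolation (\<open>node_eval_surj\<close>). The Gray map is this isomorphism followed by
  multiplication with the invertible matrix $V$, block by block, so it is $F$-linear and
  bijective. Being additive, it carries differences to differences, so the Gray distance is the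
  Hamming distance of the images.

  Write $\mathrm{ev}_k$ for the evaluation at the $k$-th node. If $V V^T = \lambda I$, then
  $\Phi(x) \cdot \Phi(y) = \lambda \sum_k \mathrm{ev}_k (x \cdot y)$
  (\<open>gray_map_vec_inner\<close>). Hence $x \cdot y = 0$ implies $\Phi(x) \cdot \Phi(y) = 0$, which
  makes the image of a self-dual code $C$ self-orthogonal. Conversely, let $\Phi(x)$ be
  orthogonal to $\Phi(C)$, let $y \in C$, and let $e \in R$ be the idempotent with
  $\mathrm{ev}_k (e) = 1$ that vanishes at the other nodes. Then $e y \in C$, so
  $0 = \Phi(x) \cdot \Phi(e y) = \lambda\, \mathrm{ev}_k (x \cdot y)$. As this holds for
  every $k$, $x \cdot y = 0$; thus $x \in C^\perp = C$ (\<open>self_dual_gray_image\<close>).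
\<close>


section \<open>Evaluating residue classes\<close>

text \<open>The residue class of a polynomial.\<close>

abbreviation gray_class :: "nat \<Rightarrow> 'a::comm_ring_1 poly \<Rightarrow> 'a poly set" where
  "gray_class m f \<equiv> gray_ideal m +>\<^bsub>class_ring\<^esub> f"

text \<open>The roots $0, 1, \xi, \ldots, \xi^{m-2}$ of $u^m - u$, in the order used by the Gray map.\<close>

definition gray_node :: "'a::comm_ring_1 \<Rightarrow> nat \<Rightarrow> 'a" where
  "gray_node \<xi> k = (if k = 0 then 0 else \<xi> ^ (k - 1))"

text \<open>The value of a residue class at the node \<open>k\<close>, read off from its reduced representative.\<close>

definition node_eval :: "nat \<Rightarrow> 'a::comm_ring_1 \<Rightarrow> nat \<Rightarrow> 'a poly set \<Rightarrow> 'a" where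
  "node_eval m \<xi> k r = poly (coset_rep m r) (gray_node \<xi> k)"

lemma gray_class_hom:
  "ring_hom_ring class_ring (gray_ring m) (gray_class m :: 'a::comm_ring_1 poly \<Rightarrow> _)"
proof -
  have "ideal (gray_ideal m :: 'a poly set) class_ring"
    unfolding gray_ideal_def by (intro ring.genideal_ideal class_ring.ring_axioms) simp
  then show ?thesis
    unfolding gray_ring_def by (rule ideal.rcos_ring_hom_ring)
qed

lemmas gray_class_closed = ring_hom_ring.homh [OF gray_class_hom, THEN ring_hom_closed, simplified]
  and gray_class_mult = ring_hom_ring.homh [OF gray_class_hom, THEN ring_hom_mult, simplified]
  and gray_class_add = ring_hom_ring.homh [OF gray_class_hom, THEN ring_hom_add, simplified]
  and gray_class_one = ring_hom_ring.homh [OF gray_class_hom, THEN ring_hom_one, simplified]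

lemma in_gray_class:
  "h \<in> gray_class m f \<longleftrightarrow> (\<exists>q. h = q * (monom 1 m - monom 1 1) + f)"
  by (auto simp: a_r_coset_def' gray_ideal_eq)

lemma gray_class_surj:
  fixes r :: "'a::comm_ring_1 poly set"
  assumes "r \<in> carrier (gray_ring m)"
  obtains f where "r = gray_class m f"
  using assms by (auto simp: gray_ring_def FactRing_def A_RCOSETS_def' a_r_coset_def')

lemma gray_class_eq:
  assumes "h \<in> gray_class m f"
  shows "gray_class m h = gray_class m f"
proof -
  obtain q where h: "h = q * (monom 1 m - monom 1 1) + f"
    using assms by (auto simp: in_gray_class)
  have "x \<in> gray_class m h \<longleftrightarrow> x \<in> gray_class m f" for x
  proof
    assume "x \<in> gray_class m h"
    then obtain p where "x = p * (monom 1 m - monom 1 1) + h"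
      by (auto simp: in_gray_class)
    then have "x = (p + q) * (monom 1 m - monom 1 1) + f"
      by (simp add: h algebra_simps)
    then show "x \<in> gray_class m f"
      unfolding in_gray_class by blast
  next
    assume "x \<in> gray_class m f"
    then obtain p where "x = p * (monom 1 m - monom 1 1) + f"
      by (auto simp: in_gray_class)
    then have "x = (p - q) * (monom 1 m - monom 1 1) + h"
      by (simp add: h algebra_simps)
    then show "x \<in> gray_class m h"
      unfolding in_gray_class by blast
  qed
  then show ?thesis by blast
qed

lemma coset_rep_properties:
  fixes r :: "'a::field poly set"
  assumes "m \<ge> 2" and "r \<in> carrier (gray_ring m)"
  shows "coset_rep m r \<in> r" and "degree (coset_rep m r) < m"
  using theI'[OF coset_rep_unique[OF assms]] unfolding coset_rep_def by auto

lemma gray_class_coset_rep: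
  fixes r :: "'a::field poly set"
  assumes "m \<ge> 2" and "r \<in> carrier (gray_ring m)"
  shows "gray_class m (coset_rep m r) = r"
  using gray_class_surj[OF assms(2)] gray_class_eq coset_rep_properties(1)[OF assms] by metis

text \<open>
  The polynomial \<open>b k\<close> in the proof is the unnormalised Lagrange basis polynomial, which
  vanishes at all nodes except the \<open>k\<close>-th.
\<close>

lemma interpolation_exists:
  fixes x c :: "nat \<Rightarrow> 'a::field"
  assumes "inj_on x {..<m}"
  shows "\<exists>f. \<forall>k<m. poly f (x k) = c k"
proof -
  define b where "b k = (\<Prod>j\<in>{..<m} - {k}. [:- x j, 1:])" for k
  define f where "f = (\<Sum>k<m. [:c k / poly (b k) (x k):] * b k)"
  have b: "poly (b k) (x i) = (\<Prod>j\<in>{..<m} - {k}. x i - x j)" for k i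
    by (simp add: b_def poly_prod)
  have diag: "poly (b k) (x k) \<noteq> 0" if "k < m" for k
    using assms that by (auto simp: b inj_on_def)
  have off: "poly (b k) (x i) = 0" if "i < m" "i \<noteq> k" for i k
    using that by (auto simp: b intro!: prod_zero)
  have "poly f (x i) = c i" if "i < m" for i
  proof -
    have "poly f (x i) = (\<Sum>k<m. c k / poly (b k) (x k) * poly (b k) (x i))"
      by (simp add: f_def poly_sum)
    also have "\<dots> = (\<Sum>k<m. if k = i then c i else 0)"
      using that by (intro sum.cong) (auto simp: off diag)
    also have "\<dots> = c i"
      using that by simp
    finally show ?thesis .
  qed
  then show ?thesis by blast
qed

text \<open>
  The hypotheses say that $u^m - u$ splits with the $m$ pairwise different roots
  $0, 1, \xi, \ldots, \xi^{m-2}$.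
\<close>

locale gray_points =
  fixes m :: nat and \<xi> :: "'a::field"
  assumes m_ge: "m \<ge> 2"
    and root_of_unity: "\<xi> ^ (m - 1) = 1"
    and powers_distinct: "inj_on (\<lambda>k. \<xi> ^ k) {..<m - 1}"
begin

abbreviation "GR \<equiv> gray_ring m :: 'a poly set ring"
abbreviation "ev \<equiv> node_eval m \<xi>"

lemma root_nonzero: "\<xi> \<noteq> 0"
  using root_of_unity m_ge by (cases "\<xi> = 0") (auto simp: power_0_left)

lemma node_power: "gray_node \<xi> k ^ m = gray_node \<xi> k"
proof (cases "k = 0")
  case True
  then show ?thesis using m_ge by (simp add: gray_node_def)
next
  case False
  have "gray_node \<xi> k ^ m = gray_node \<xi> k ^ (m - 1) * gray_node \<xi> k"
    using m_ge by (subst power_Suc2[symmetric]) simp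
  also have "gray_node \<xi> k ^ (m - 1) = (\<xi> ^ (m - 1)) ^ (k - 1)"
    using False by (simp add: gray_node_def power_mult[symmetric] mult.commute)
  finally show ?thesis by (simp only: root_of_unity power_one mult_1_left)
qed

lemma node_inj: "inj_on (gray_node \<xi>) {..<m}"
proof (rule inj_onI)
  fix i j assume ij: "i \<in> {..<m}" "j \<in> {..<m}" "gray_node \<xi> i = gray_node \<xi> j"
  show "i = j"
  proof (cases "i = 0 \<or> j = 0")
    case True
    then show ?thesis using ij(3) root_nonzero by (auto simp: gray_node_def split: if_splits)
  next
    case False
    then have "i - 1 = j - 1"
      using ij by (intro inj_onD[OF powers_distinct]) (auto simp: gray_node_def)
    then show ?thesis using False by linarith
  qed
qed

lemma node_eval_gray_class: "ev k (gray_class m f) = poly f (gray_node \<xi> k)"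
proof -
  have "coset_rep m (gray_class m f) \<in> gray_class m f"
    by (rule coset_rep_properties(1)[OF m_ge gray_class_closed])
  then obtain q where "coset_rep m (gray_class m f) = q * (monom 1 m - monom 1 1) + f"
    by (auto simp: in_gray_class)
  then show ?thesis
    by (simp add: node_eval_def poly_monom node_power)
qed

lemma node_eval_hom: "ring_hom_cring GR class_ring (ev k)"
proof -
  have "ring_hom_ring GR class_ring (ev k)"
  proof (rule ring_hom_ringI)
    show "ring GR" by (intro cring.axioms(1) cring_gray_ring)
    show "ring (class_ring :: 'a ring)" by (rule class_ring.ring_axioms)
    show "ev k \<one>\<^bsub>GR\<^esub> = \<one>\<^bsub>class_ring\<^esub>"
      by (simp add: gray_class_one[symmetric] node_eval_gray_class)
    fix r s assume "r \<in> carrier GR" "s \<in> carrier GR"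
    then obtain f g where rs: "r = gray_class m f" "s = gray_class m g"
      by (meson gray_class_surj)
    show "ev k (r \<otimes>\<^bsub>GR\<^esub> s) = ev k r \<otimes>\<^bsub>class_ring\<^esub> ev k s"
      by (simp add: rs gray_class_mult[symmetric] node_eval_gray_class)
    show "ev k (r \<oplus>\<^bsub>GR\<^esub> s) = ev k r \<oplus>\<^bsub>class_ring\<^esub> ev k s"
      by (simp add: rs gray_class_add[symmetric] node_eval_gray_class)
  qed simp
  then show ?thesis
    by (intro ring_hom_cringI cring_gray_ring class_cring.cring_axioms ring_hom_ring.homh)
qed

lemma node_eval_ring [simp]:
  "r \<in> carrier GR \<Longrightarrow> s \<in> carrier GR \<Longrightarrow> ev k (r \<otimes>\<^bsub>GR\<^esub> s) = ev k r * ev k s"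
  "r \<in> carrier GR \<Longrightarrow> s \<in> carrier GR \<Longrightarrow> ev k (r \<oplus>\<^bsub>GR\<^esub> s) = ev k r + ev k s"
  "ev k \<zero>\<^bsub>GR\<^esub> = 0"
proof -
  interpret ring_hom_cring GR class_ring "ev k" by (rule node_eval_hom)
  show "r \<in> carrier GR \<Longrightarrow> s \<in> carrier GR \<Longrightarrow> ev k (r \<otimes>\<^bsub>GR\<^esub> s) = ev k r * ev k s"
    "r \<in> carrier GR \<Longrightarrow> s \<in> carrier GR \<Longrightarrow> ev k (r \<oplus>\<^bsub>GR\<^esub> s) = ev k r + ev k s"
    "ev k \<zero>\<^bsub>GR\<^esub> = 0" by simp_all
qed

lemma node_eval_finsum:
  assumes "\<And>i. i \<in> A \<Longrightarrow> f i \<in> carrier GR"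
  shows "ev k (\<Oplus>\<^bsub>GR\<^esub>i\<in>A. f i) = (\<Sum>i\<in>A. ev k (f i))"
proof -
  interpret ring_hom_cring GR class_ring "ev k" by (rule node_eval_hom)
  show ?thesis
    using assms by (subst hom_finsum) (auto simp: class_ring_simps o_def)
qed

text \<open>
  The reduced representative has degree less than $m$, hence is determined by its values
  at $m$ different points.
\<close>

lemma node_eval_inject:
  assumes "r \<in> carrier GR" "s \<in> carrier GR" and "\<And>k. k < m \<Longrightarrow> ev k r = ev k s"
  shows "r = s"
proof -
  have "card (gray_node \<xi> ` {..<m}) = m"
    by (simp add: card_image node_inj)
  then have "coset_rep m r = coset_rep m s"
    using assms coset_rep_properties(2)[OF m_ge]
    by (intro poly_eqI_degree[of "gray_node \<xi> ` {..<m}"]) (auto simp: node_eval_def)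
  then show ?thesis
    using gray_class_coset_rep[OF m_ge] assms(1,2) by metis
qed

lemma node_eval_surj:
  obtains r where "r \<in> carrier GR" "\<And>k. k < m \<Longrightarrow> ev k r = c k"
  using interpolation_exists[OF node_inj, of c] gray_class_closed node_eval_gray_class by metis

lemma const_coset_closed: "const_coset m a \<in> carrier GR"
  by (simp add: const_coset_def gray_class_closed)

lemma node_eval_const: "ev k (const_coset m a) = a"
  by (simp add: const_coset_def node_eval_gray_class)

end


section \<open>Free modules and blocks\<close>

lemma free_module_simps:
  "x \<in> carrier (free_module R n) \<longleftrightarrow> dim_vec x = n \<and> (\<forall>i<n. x $ i \<in> carrier R)"
  "x \<oplus>\<^bsub>free_module R n\<^esub> y = vec n (\<lambda>i. x $ i \<oplus>\<^bsub>R\<^esub> y $ i)"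
  "a \<odot>\<^bsub>free_module R n\<^esub> x = vec n (\<lambda>i. a \<otimes>\<^bsub>R\<^esub> x $ i)"
  "\<zero>\<^bsub>free_module R n\<^esub> = vec n (\<lambda>_. \<zero>\<^bsub>R\<^esub>)"
  by (auto simp: free_module_def)

lemma module_restrict_scalars:
  assumes "cring K" and "module R M" and "\<phi> \<in> Ring.ring_hom K R"
  shows "module K (restrict_scalars \<phi> M)"
proof -
  interpret K: cring K by fact
  interpret M: Module.module R M by fact
  note hom = ring_hom_closed[OF assms(3)] ring_hom_mult[OF assms(3)]
    ring_hom_add[OF assms(3)] ring_hom_one[OF assms(3)]
  have "abelian_group (restrict_scalars \<phi> M)"
  proof (rule abelian_groupI, goal_cases)
    case (6 x)
    then show ?case
      using M.l_neg[of x] M.a_inv_closed[of x] by (auto simp: restrict_scalars_def)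
  qed (simp_all add: restrict_scalars_def M.a_assoc M.a_comm M.a_lcomm)
  then show ?thesis
    by (intro moduleI assms(1))
      (simp_all add: restrict_scalars_def hom M.smult_l_distr M.smult_r_distr M.smult_assoc1)
qed

text \<open>Position $a m + b$ of a vector of length $m n$ is position $b$ of block $a$.\<close>

lemma sum_blocks:
  fixes f :: "nat \<Rightarrow> 'b::comm_monoid_add"
  shows "(\<Sum>i<m * n. f i) = (\<Sum>a<n. \<Sum>b<m. f (a * m + b))"
proof -
  have "(\<Sum>i\<in>{a * m..<a * m + m}. f i) = (\<Sum>b<m. f (a * m + b))" for a
    by (rule sum.reindex_bij_witness[of _ "\<lambda>b. a * m + b" "\<lambda>i. i - a * m"]) auto
  then show ?thesis
    using sum.nat_group[of f m n] by (simp add: mult.commute)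
qed

lemma block_index:
  assumes "i < m * (n :: nat)"
  shows "i div m < n" "i mod m < m"
proof -
  have "m > 0" using assms by (cases m) auto
  then show "i mod m < m" by simp
  show "i div m < n" using assms by (simp add: less_mult_imp_div_less mult.commute)
qed

lemma block_index_less:
  assumes "a < n" "b < (m :: nat)"
  shows "a * m + b < m * n"
proof -
  have "a * m + b < Suc a * m" using assms by simp
  also have "\<dots> \<le> n * m" using assms by (intro mult_le_mono1) simp
  finally show ?thesis by (simp add: mult.commute)
qed

lemma card_below_eq_sum: "card {i. i < (N :: nat) \<and> P i} = (\<Sum>i<N. if P i then 1 else 0)"
  using sum.inter_filter[of "{..<N}" "\<lambda>_. 1 :: nat" P] by simp

lemma mult_mat_entry:
  assumes "A \<in> carrier_mat m m" "B \<in> carrier_mat m m" "i < m" "j < m"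
  shows "(A * B) $$ (i, j) = (\<Sum>k<m. A $$ (i, k) * B $$ (k, j))"
  using assms by (auto simp: scalar_prod_def lessThan_atLeast0 intro!: sum.cong)


section \<open>The Gray map\<close>

text \<open>The matrix \<open>W\<close> is the inverse of \<open>V\<close>; it recovers the values at the nodes from the Gray image.\<close>

locale gray_matrix = gray_points m \<xi> for m and \<xi> :: "'a::field" +
  fixes V W :: "'a mat"
  assumes V: "V \<in> carrier_mat m m" and W: "W \<in> carrier_mat m m"
    and VW: "V * W = 1\<^sub>m m" and WV: "W * V = 1\<^sub>m m"
begin

abbreviation "gray \<equiv> gray_map m \<xi> V"
abbreviation "Gray \<equiv> gray_map_vec m \<xi> V"

lemma gray_map_index: "j < m \<Longrightarrow> gray r $ j = (\<Sum>k<m. ev k r * V $$ (k, j))"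
  using V by (auto simp: gray_map_def eval_vec_def node_eval_def gray_node_def scalar_prod_def
      lessThan_atLeast0 intro!: sum.cong)

lemma gray_map_dim: "dim_vec (gray r) = m"
  by (simp add: gray_map_def)

lemma gray_map_add:
  assumes "j < m" "r \<in> carrier GR" "s \<in> carrier GR"
  shows "gray (r \<oplus>\<^bsub>GR\<^esub> s) $ j = gray r $ j + gray s $ j"
  using assms by (simp add: gray_map_index sum.distrib algebra_simps)

lemma gray_map_scale:
  assumes "j < m" "r \<in> carrier GR"
  shows "gray (const_coset m a \<otimes>\<^bsub>GR\<^esub> r) $ j = a * gray r $ j"
  using assms by (simp add: gray_map_index const_coset_closed node_eval_const sum_distrib_left mult.assoc)

lemma node_eval_from_gray_map:
  assumes "k < m"
  shows "ev k r = (\<Sum>j<m. gray r $ j * W $$ (j, k))"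
proof -
  have "(\<Sum>j<m. gray r $ j * W $$ (j, k)) = (\<Sum>j<m. \<Sum>l<m. ev l r * (V $$ (l, j) * W $$ (j, k)))"
    by (simp add: gray_map_index sum_distrib_right mult.assoc)
  also have "\<dots> = (\<Sum>l<m. ev l r * (V * W) $$ (l, k))"
    using assms by (subst sum.swap) (simp add: mult_mat_entry[OF V W] sum_distrib_left)
  also have "\<dots> = (\<Sum>l<m. if l = k then ev k r else 0)"
    using assms by (intro sum.cong) (auto simp: VW)
  finally show ?thesis using assms by simp
qed

lemma gray_map_inject:
  assumes "r \<in> carrier GR" "s \<in> carrier GR" and "\<And>j. j < m \<Longrightarrow> gray r $ j = gray s $ j"
  shows "r = s"
  using assms by (intro node_eval_inject) (auto simp: node_eval_from_gray_map)

lemma gray_map_surj: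
  obtains r where "r \<in> carrier GR" "\<And>j. j < m \<Longrightarrow> gray r $ j = c j"
proof -
  obtain r where r: "r \<in> carrier GR" "\<And>k. k < m \<Longrightarrow> ev k r = (\<Sum>i<m. c i * W $$ (i, k))"
    using node_eval_surj[of "\<lambda>k. \<Sum>i<m. c i * W $$ (i, k)"] by blast
  have "gray r $ j = c j" if j: "j < m" for j
  proof -
    have "gray r $ j = (\<Sum>k<m. \<Sum>i<m. c i * (W $$ (i, k) * V $$ (k, j)))"
      by (simp add: gray_map_index j r(2) sum_distrib_right mult.assoc)
    also have "\<dots> = (\<Sum>i<m. c i * (W * V) $$ (i, j))"
      using j by (subst sum.swap) (simp add: mult_mat_entry[OF W V] sum_distrib_left)
    also have "\<dots> = (\<Sum>i<m. if i = j then c j else 0)"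
      using j by (intro sum.cong) (auto simp: WV)
    finally show ?thesis using j by simp
  qed
  with r(1) show ?thesis by (rule that)
qed

lemma gray_map_vec_dim: "dim_vec (Gray n x) = m * n"
  by (simp add: gray_map_vec_def)

lemma gray_map_vec_index: "i < m * n \<Longrightarrow> Gray n x $ i = gray (x $ (i div m)) $ (i mod m)"
  by (simp add: gray_map_vec_def)

lemma gray_map_vec_block:
  "a < n \<Longrightarrow> b < m \<Longrightarrow> Gray n x $ (a * m + b) = gray (x $ a) $ b"
  using block_index_less[of a n b m] by (simp add: gray_map_vec_index)

lemma gray_map_vec_closed: "Gray n x \<in> carrier (free_module class_ring (m * n))"
  by (simp add: free_module_simps gray_map_vec_dim)

lemma gray_map_vec_add:
  assumes "x \<in> carrier (free_module GR n)" "y \<in> carrier (free_module GR n)"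
  shows "Gray n (x \<oplus>\<^bsub>free_module GR n\<^esub> y) = Gray n x \<oplus>\<^bsub>free_module class_ring (m * n)\<^esub> Gray n y"
  using assms block_index[of _ m n]
  by (intro eq_vecI) (auto simp: free_module_simps gray_map_vec_dim gray_map_vec_index gray_map_add)

lemma gray_map_vec_smult:
  assumes "x \<in> carrier (free_module GR n)"
  shows "Gray n (const_coset m a \<odot>\<^bsub>free_module GR n\<^esub> x)
    = a \<odot>\<^bsub>free_module class_ring (m * n)\<^esub> Gray n x"
  using assms block_index[of _ m n]
  by (intro eq_vecI) (auto simp: free_module_simps gray_map_vec_dim gray_map_vec_index gray_map_scale)

lemma gray_map_vec_zero:
  "Gray n \<zero>\<^bsub>free_module GR n\<^esub> = \<zero>\<^bsub>free_module class_ring (m * n)\<^esub>"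
  using block_index[of _ m n]
  by (intro eq_vecI) (auto simp: free_module_simps gray_map_vec_dim gray_map_vec_index gray_map_index)

lemma const_coset_hom: "const_coset m \<in> Ring.ring_hom class_ring GR"
proof (rule ring_hom_memI)
  fix a b :: 'a
  show "const_coset m a \<in> carrier GR" by (rule const_coset_closed)
  show "const_coset m (a \<otimes>\<^bsub>class_ring\<^esub> b) = const_coset m a \<otimes>\<^bsub>GR\<^esub> const_coset m b"
    by (simp add: const_coset_def gray_class_mult[symmetric] mult.commute)
  show "const_coset m (a \<oplus>\<^bsub>class_ring\<^esub> b) = const_coset m a \<oplus>\<^bsub>GR\<^esub> const_coset m b"
    by (simp add: const_coset_def gray_class_add[symmetric])
next
  show "const_coset m \<one>\<^bsub>class_ring\<^esub> = \<one>\<^bsub>GR\<^esub>"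
    by (simp add: const_coset_def gray_class_one[symmetric] pCons_one)
qed

lemma gray_map_vec_linear:
  "mod_hom class_ring (restrict_scalars (const_coset m) (free_module GR n))
     (free_module class_ring (m * n)) (Gray n)"
proof -
  have "module class_ring (restrict_scalars (const_coset m) (free_module GR n))"
    by (rule module_restrict_scalars[OF class_cring.cring_axioms
          module_free_module[OF cring_gray_ring] const_coset_hom])
  moreover have "module class_ring (free_module class_ring (m * n) :: ('a, 'a vec) module)"
    by (rule module_free_module[OF class_cring.cring_axioms])
  ultimately show ?thesis
    unfolding mod_hom_def mod_hom_axioms_def LinearCombinations.module_hom_def
    by (simp add: restrict_scalars_def gray_map_vec_closed gray_map_vec_add gray_map_vec_smult)
qed

lemma gray_map_vec_bij:
  "bij_betw (Gray n) (carrier (free_module GR n)) (carrier (free_module class_ring (m * n)))"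
proof (rule bij_betw_imageI)
  show "inj_on (Gray n) (carrier (free_module GR n))"
  proof (rule inj_onI)
    fix x y assume x: "x \<in> carrier (free_module GR n)" and y: "y \<in> carrier (free_module GR n)"
      and eq: "Gray n x = Gray n y"
    have "x $ a = y $ a" if a: "a < n" for a
    proof (rule gray_map_inject)
      show "x $ a \<in> carrier GR" "y $ a \<in> carrier GR"
        using a x y by (simp_all add: free_module_simps)
      show "gray (x $ a) $ b = gray (y $ a) $ b" if "b < m" for b
        using gray_map_vec_block[OF a that, of x] gray_map_vec_block[OF a that, of y] eq by simp
    qed
    then show "x = y"
      using x y by (intro eq_vecI) (auto simp: free_module_simps)
  qed
  show "Gray n ` carrier (free_module GR n) = carrier (free_module class_ring (m * n))"
  proof (intro equalityI subsetI)
    fix z :: "'a vec" assume z: "z \<in> carrier (free_module class_ring (m * n))"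
    have "\<exists>r. r \<in> carrier GR \<and> (\<forall>b<m. gray r $ b = z $ (a * m + b))" for a
      using gray_map_surj[of "\<lambda>b. z $ (a * m + b)"] by metis
    then obtain r where r: "\<And>a. r a \<in> carrier GR" "\<And>a b. b < m \<Longrightarrow> gray (r a) $ b = z $ (a * m + b)"
      by metis
    have "Gray n (vec n r) = z"
      using z block_index[of _ m n]
      by (intro eq_vecI) (auto simp: free_module_simps gray_map_vec_dim gray_map_vec_index r)
    moreover have "vec n r \<in> carrier (free_module GR n)"
      by (simp add: free_module_simps r)
    ultimately show "z \<in> Gray n ` carrier (free_module GR n)" by blast
  qed (auto simp: gray_map_vec_closed)
qed

lemma gray_map_vec_isometry:
  assumes x: "x \<in> carrier (free_module GR n)" and y: "y \<in> carrier (free_module GR n)"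
  shows "hamming_dist (Gray n x) (Gray n y) = gray_dist m \<xi> V n x y"
proof -
  interpret M: Module.module GR "free_module GR n"
    by (rule module_free_module[OF cring_gray_ring])
  \<comment> \<open>The subtraction in the free module is used only through \<open>x = z + y\<close>, which the additive
    Gray map preserves.\<close>
  define z where "z = x \<ominus>\<^bsub>free_module GR n\<^esub> y"
  have z: "z \<in> carrier (free_module GR n)"
    using x y by (simp add: z_def)
  have zy: "x = z \<oplus>\<^bsub>free_module GR n\<^esub> y"
    using x y by (simp add: z_def a_minus_def M.a_assoc M.l_neg)
  have diff: "gray (x $ a) $ b = gray (z $ a) $ b + gray (y $ a) $ b" if "a < n" "b < m" for a b
    using that y z by (simp add: zy free_module_simps gray_map_add)
  have "hamming_dist (Gray n x) (Gray n y)
      = (\<Sum>i<m * n. if Gray n x $ i \<noteq> Gray n y $ i then 1 else 0)"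
    by (simp only: hamming_dist_def card_below_eq_sum gray_map_vec_dim)
  also have "\<dots> = (\<Sum>a<n. \<Sum>b<m. if gray (z $ a) $ b \<noteq> 0 then 1 else 0)"
    unfolding sum_blocks by (intro sum.cong refl) (simp add: gray_map_vec_block diff)
  also have "\<dots> = gray_dist m \<xi> V n x y"
    by (simp only: gray_dist_def gray_weight_vec_def gray_weight_def hamming_weight_def
        card_below_eq_sum gray_map_dim z_def)
  finally show ?thesis .
qed


subsection \<open>Self-dual codes\<close>

lemma gray_map_inner:
  assumes orth: "V * transpose_mat V = c \<cdot>\<^sub>m 1\<^sub>m m"
  shows "(\<Sum>j<m. gray r $ j * gray s $ j) = c * (\<Sum>k<m. ev k r * ev k s)"
proof -
  have entry: "(\<Sum>j<m. V $$ (k, j) * V $$ (l, j)) = (if l = k then c else 0)"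
    if "k < m" "l < m" for k l
  proof -
    have "(\<Sum>j<m. V $$ (k, j) * V $$ (l, j)) = (V * transpose_mat V) $$ (k, l)"
      using that V by (subst mult_mat_entry[OF V]) auto
    then show ?thesis using that by (simp add: orth)
  qed
  have "(\<Sum>j<m. gray r $ j * gray s $ j)
      = (\<Sum>j<m. \<Sum>k<m. \<Sum>l<m. (ev k r * ev l s) * (V $$ (k, j) * V $$ (l, j)))"
    by (simp add: gray_map_index sum_product mult_ac)
  also have "\<dots> = (\<Sum>k<m. \<Sum>j<m. \<Sum>l<m. (ev k r * ev l s) * (V $$ (k, j) * V $$ (l, j)))"
    by (rule sum.swap)
  also have "\<dots> = (\<Sum>k<m. \<Sum>l<m. \<Sum>j<m. (ev k r * ev l s) * (V $$ (k, j) * V $$ (l, j)))"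
    by (intro sum.cong refl sum.swap)
  also have "\<dots> = (\<Sum>k<m. \<Sum>l<m. if l = k then c * (ev k r * ev k s) else 0)"
    by (intro sum.cong refl) (simp add: sum_distrib_left[symmetric] entry)
  finally show ?thesis
    by (simp add: sum_distrib_left)
qed

lemma euclidean_inner_closed:
  assumes "x \<in> carrier (free_module GR n)" "y \<in> carrier (free_module GR n)"
  shows "euclidean_inner GR n x y \<in> carrier GR"
proof -
  interpret cring GR by (rule cring_gray_ring)
  show ?thesis
    using assms unfolding euclidean_inner_def by (intro finsum_closed) (auto simp: free_module_simps)
qed

lemma node_eval_euclidean_inner:
  assumes "x \<in> carrier (free_module GR n)" "y \<in> carrier (free_module GR n)"
  shows "ev k (euclidean_inner GR n x y) = (\<Sum>a<n. ev k (x $ a) * ev k (y $ a))"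
proof -
  interpret cring GR by (rule cring_gray_ring)
  show ?thesis
    using assms unfolding euclidean_inner_def by (subst node_eval_finsum) (simp_all add: free_module_simps)
qed

lemma gray_map_vec_inner:
  assumes orth: "V * transpose_mat V = c \<cdot>\<^sub>m 1\<^sub>m m"
    and x: "x \<in> carrier (free_module GR n)" and y: "y \<in> carrier (free_module GR n)"
  shows "euclidean_inner class_ring (m * n) (Gray n x) (Gray n y)
    = c * (\<Sum>k<m. ev k (euclidean_inner GR n x y))"
proof -
  have "euclidean_inner class_ring (m * n) (Gray n x) (Gray n y)
      = (\<Sum>i<m * n. Gray n x $ i * Gray n y $ i)"
    by (simp add: euclidean_inner_def class_ring_simps)
  also have "\<dots> = (\<Sum>a<n. c * (\<Sum>k<m. ev k (x $ a) * ev k (y $ a)))"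
    by (simp add: sum_blocks gray_map_vec_block gray_map_inner[OF orth])
  also have "\<dots> = c * (\<Sum>k<m. \<Sum>a<n. ev k (x $ a) * ev k (y $ a))"
    by (subst sum.swap) (simp add: sum_distrib_left)
  also have "\<dots> = c * (\<Sum>k<m. ev k (euclidean_inner GR n x y))"
    by (simp add: node_eval_euclidean_inner[OF x y])
  finally show ?thesis .
qed

lemma linear_code_gray_image:
  assumes "linear_code GR n C"
  shows "linear_code class_ring (m * n) (Gray n ` C)"
proof -
  interpret C: LinearCombinations.submodule GR C "free_module GR n"
    using assms by (simp add: linear_code_def)
  show ?thesis
    unfolding linear_code_def
  proof (rule LinearCombinations.submodule.intro)
    show "module class_ring (free_module class_ring (m * n) :: ('a, 'a vec) module)"
      by (rule module_free_module[OF class_cring.cring_axioms])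
    show "Gray n ` C \<subseteq> carrier (free_module class_ring (m * n))"
      by (auto simp: gray_map_vec_closed)
    show "\<zero>\<^bsub>free_module class_ring (m * n)\<^esub> \<in> Gray n ` C"
      by (metis C.zero_closed gray_map_vec_zero imageI)
  next
    fix v w assume "v \<in> Gray n ` C" "w \<in> Gray n ` C"
    then show "v \<oplus>\<^bsub>free_module class_ring (m * n)\<^esub> w \<in> Gray n ` C"
      using C.subset by (auto simp: gray_map_vec_add[symmetric] subset_iff)
  next
    fix a :: 'a and v assume "v \<in> Gray n ` C"
    then show "a \<odot>\<^bsub>free_module class_ring (m * n)\<^esub> v \<in> Gray n ` C"
      using C.subset const_coset_closed by (auto simp: gray_map_vec_smult[symmetric] subset_iff)
  qed
qed

lemma self_dual_gray_image:
  assumes c: "c \<noteq> 0" and orth: "V * transpose_mat V = c \<cdot>\<^sub>m 1\<^sub>m m"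
    and C: "self_dual_code GR n C"
  shows "self_dual_code class_ring (m * n) (Gray n ` C)"
proof -
  let ?M = "free_module GR n"
  let ?N = "free_module class_ring (m * n) :: ('a, 'a vec) module"
  interpret C: LinearCombinations.submodule GR C ?M
    using C by (simp add: self_dual_code_def linear_code_def)
  have dual: "C = dual_code GR n C"
    using C by (simp add: self_dual_code_def)
  have sub: "x \<in> carrier ?M" if "x \<in> C" for x
    using that C.subset by blast
  have "Gray n ` C = dual_code class_ring (m * n) (Gray n ` C)"
  proof (intro equalityI subsetI)
    fix z assume "z \<in> Gray n ` C"
    then obtain x where x: "x \<in> C" and z: "z = Gray n x" by blast
    have "euclidean_inner class_ring (m * n) z (Gray n y) = 0" if y: "y \<in> C" for y
    proof -
      have "euclidean_inner GR n x y = \<zero>\<^bsub>GR\<^esub>"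
        using dual x y by (auto simp: dual_code_def)
      then show ?thesis
        by (simp add: z gray_map_vec_inner[OF orth sub[OF x] sub[OF y]])
    qed
    then show "z \<in> dual_code class_ring (m * n) (Gray n ` C)"
      by (auto simp: dual_code_def z gray_map_vec_closed)
  next
    fix z assume z: "z \<in> dual_code class_ring (m * n) (Gray n ` C)"
    then have "z \<in> carrier ?N" by (simp add: dual_code_def)
    then obtain x where x: "x \<in> carrier ?M" and zx: "z = Gray n x"
      using gray_map_vec_bij[of n] by (auto simp: bij_betw_def)
    have "euclidean_inner GR n x y = \<zero>\<^bsub>GR\<^esub>" if y: "y \<in> C" for y
    proof (rule node_eval_inject)
      show "euclidean_inner GR n x y \<in> carrier GR"
        by (intro euclidean_inner_closed x sub y)
      show "\<zero>\<^bsub>GR\<^esub> \<in> carrier GR"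
        using cring_gray_ring by (intro cring.cring_simprules)
    next
      fix k assume k: "k < m"
      \<comment> \<open>Scaling by the idempotent $e$ that is $1$ at the node $k$ and $0$ at the other nodes
        isolates one term of the sum over the nodes.\<close>
      obtain e where e: "e \<in> carrier GR" "\<And>l. l < m \<Longrightarrow> ev l e = (if l = k then 1 else 0)"
        using node_eval_surj[of "\<lambda>l. if l = k then 1 else 0"] by blast
      let ?y = "e \<odot>\<^bsub>?M\<^esub> y"
      have ey: "?y \<in> C" using e(1) y by simp
      have val: "ev l (euclidean_inner GR n x ?y)
          = (if l = k then ev k (euclidean_inner GR n x y) else 0)" if l: "l < m" for l
      proof -
        have "ev l (euclidean_inner GR n x ?y) = (\<Sum>a<n. ev l (x $ a) * ev l (?y $ a))"
          by (rule node_eval_euclidean_inner[OF x sub[OF ey]])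
        also have "\<dots> = (\<Sum>a<n. ev l (x $ a) * (ev l e * ev l (y $ a)))"
          using sub[OF y] e(1) by (intro sum.cong refl) (simp add: free_module_simps)
        also have "\<dots> = ev l e * ev l (euclidean_inner GR n x y)"
          by (simp add: node_eval_euclidean_inner[OF x sub[OF y]] sum_distrib_left mult_ac)
        finally show ?thesis using e(2)[OF l] by simp
      qed
      have "0 = euclidean_inner class_ring (m * n) z (Gray n ?y)"
        using z ey by (auto simp: dual_code_def)
      also have "\<dots> = c * (\<Sum>l<m. ev l (euclidean_inner GR n x ?y))"
        unfolding zx by (rule gray_map_vec_inner[OF orth x sub[OF ey]])
      also have "\<dots> = c * (\<Sum>l<m. if l = k then ev k (euclidean_inner GR n x y) else 0)"
        by (simp add: val)
      also have "\<dots> = c * ev k (euclidean_inner GR n x y)"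
        using k by simp
      finally show "ev k (euclidean_inner GR n x y) = ev k \<zero>\<^bsub>GR\<^esub>"
        using c by simp
    qed
    then have "x \<in> C"
      using x by (subst dual) (simp add: dual_code_def)
    then show "z \<in> Gray n ` C" by (simp add: zx)
  qed
  then show ?thesis
    using C linear_code_gray_image by (simp add: self_dual_code_def)
qed

end


section \<open>Primitive elements\<close>

text \<open>
  The powers of a primitive element repeat with period $q - 1$, where $q$ is the number of field
  elements, and they cover all $q - 1$ nonzero elements; so those in one period are different.
\<close>

lemma primitive_element_powers:
  fixes \<alpha> :: "'a::finite_field"
  assumes "primitive_element \<alpha>"
  shows "\<alpha> ^ (CARD('a) - 1) = 1" and "inj_on (\<lambda>k. \<alpha> ^ k) {..<CARD('a) - 1}"
proof -
  let ?N = "CARD('a) - 1"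
  have range: "range (\<lambda>k. \<alpha> ^ k) = UNIV - {0}"
    using assms by (simp add: primitive_element_def)
  then have "\<alpha> ^ 1 \<in> UNIV - {0}" by blast
  then have nz: "\<alpha> \<noteq> 0" by simp
  have N: "?N > 0"
    using finite_UNIV_card_ge_0[where ?'a = 'a] card_mono[of UNIV "{0, 1::'a}"] by simp
  have "\<alpha> * \<alpha> ^ ?N = \<alpha>"
    using finite_field_power_card_eq_same[of \<alpha>] N by (subst power_Suc[symmetric]) simp
  then show one: "\<alpha> ^ ?N = 1"
    using nz by simp
  have "\<alpha> ^ k = \<alpha> ^ (k mod ?N)" for k
  proof -
    have "\<alpha> ^ k = (\<alpha> ^ ?N) ^ (k div ?N) * \<alpha> ^ (k mod ?N)"
      by (metis mult_div_mod_eq power_add power_mult)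
    then show ?thesis by (simp only: one power_one mult_1_left)
  qed
  then have "range (\<lambda>k. \<alpha> ^ k) \<subseteq> (\<lambda>k. \<alpha> ^ k) ` {..<?N}"
    using N by (metis image_subsetI imageI lessThan_iff mod_less_divisor)
  then have "(\<lambda>k. \<alpha> ^ k) ` {..<?N} = UNIV - {0}"
    unfolding range[symmetric] by (rule subset_antisym[OF image_mono[OF subset_UNIV]])
  then show "inj_on (\<lambda>k. \<alpha> ^ k) {..<?N}"
    by (intro eq_card_imp_inj_on) (simp_all add: card_Diff_singleton)
qed

lemma gray_points_primitive_element:
  fixes \<alpha> :: "'a::finite_field"
  assumes "m \<ge> 2" and d: "CARD('a) - 1 = d * (m - 1)" and prim: "primitive_element \<alpha>"
  shows "gray_points m (\<alpha> ^ d)"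
proof
  have "CARD('a) \<ge> 2"
    using card_mono[of UNIV "{0, 1::'a}"] by simp
  then have pos: "d > 0"
    using d by (cases "d = 0") auto
  show "m \<ge> 2" by fact
  show "(\<alpha> ^ d) ^ (m - 1) = 1"
    using primitive_element_powers(1)[OF prim] by (simp only: d power_mult)
  show "inj_on (\<lambda>k. (\<alpha> ^ d) ^ k) {..<m - 1}"
  proof (rule inj_onI)
    fix i j assume ij: "i \<in> {..<m - 1}" "j \<in> {..<m - 1}" "(\<alpha> ^ d) ^ i = (\<alpha> ^ d) ^ j"
    have "d * i = d * j"
    proof (rule inj_onD[OF primitive_element_powers(2)[OF prim]])
      show "\<alpha> ^ (d * i) = \<alpha> ^ (d * j)"
        using ij(3) by (simp only: power_mult)
      show "d * i \<in> {..<CARD('a) - 1}" "d * j \<in> {..<CARD('a) - 1}"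
        unfolding d using ij(1,2) pos by simp_all
    qed
    then show "i = j" using pos by simp
  qed
qed


section \<open>Linearity, isometry and self-duality\<close>

theorem theorem2:
  fixes m n :: nat
    and \<alpha> \<xi> :: "'p::prime_card mod_ring"
    and V :: "'p mod_ring mat"
  assumes "m \<ge> 2"
    and "[CARD('p) = 1] (mod (m - 1))"
    and "primitive_element \<alpha>"
    and "\<xi> = \<alpha> ^ ((CARD('p) - 1) div (m - 1))"
    and "V \<in> carrier_mat m m"
    and "invertible_mat V"
  shows "mod_hom class_ring
           (restrict_scalars (const_coset m) (free_module (gray_ring m) n))
           (free_module class_ring (m * n))
           (gray_map_vec m \<xi> V n)
       \<and> bij_betw (gray_map_vec m \<xi> V n)
           (carrier (free_module (gray_ring m) n))
           (carrier (free_module class_ring (m * n)))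
       \<and> (\<forall>x \<in> carrier (free_module (gray_ring m) n).
           \<forall>y \<in> carrier (free_module (gray_ring m) n).
             hamming_dist (gray_map_vec m \<xi> V n x) (gray_map_vec m \<xi> V n y)
               = gray_dist m \<xi> V n x y)
       \<and> ((\<exists>c. c \<noteq> 0 \<and> V * transpose_mat V = c \<cdot>\<^sub>m 1\<^sub>m m) \<longrightarrow>
           (\<forall>C. self_dual_code (gray_ring m) n C \<longrightarrow>
             self_dual_code class_ring (m * n) (gray_map_vec m \<xi> V n ` C)))"
proof -
  have "m - 1 dvd CARD('p) - 1"
    using assms(2) nontriv[where ?'a = 'p] by (simp add: cong_altdef_nat)
  then have "CARD('p mod_ring) - 1 = (CARD('p) - 1) div (m - 1) * (m - 1)"
    by simp
  then interpret points: gray_points m \<xi>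
    unfolding assms(4) by (intro gray_points_primitive_element assms(1,3))
  obtain W where W: "inverts_mat V W" "inverts_mat W V"
    using assms(6) by (auto simp: invertible_mat_def)
  then have VW: "V * W = 1\<^sub>m m" "W * V = 1\<^sub>m (dim_row W)"
    using assms(5) by (auto simp: inverts_mat_def)
  have "dim_col W = m" "dim_row W = m"
    using VW(1)[THEN arg_cong[where f = dim_col]] VW(2)[THEN arg_cong[where f = dim_col]] assms(5)
    by auto
  then have "gray_matrix m \<xi> V W"
    using VW assms(5) by unfold_locales auto
  then interpret gray_matrix m \<xi> V W .
  show ?thesis
    using gray_map_vec_linear gray_map_vec_bij gray_map_vec_isometry self_dual_gray_image by blast
qed

end
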